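(* Suppose that for all $b,b'\in\mathcal B$: (i) $\phi(b,t)-\phi(b',t)$ is single-crossing in $t$; and (ii) $v(b,t)-v(b',t)$ is monotonic in $t$. Then the set of minimal optimal menus of the monopolist's problem is equal to the set of minimal optimal menus of the upper-envelope problem.
   Context: Setup. There are $n\ge 1$ goods; $\mathcal B=2^{\{1,\dots,n\}}$ is the set of (deterministic) bundles and $\Delta(\mathcal B)$ is the set of probability distributions on $\mathcal B$ (stochastic bundles); a bundle $b$ is identified with the point mass at $b$. Types $t$ lie in $T=[\underline t,\bar t]\subseteq\mathbb R$, $\underline t<\bar t$, and are distributed according to $F$ with a continuous, positive density $f$. The value function $v:\Delta(\mathcal B)\times T\to\mathbb R$ is continuously differentiable in $t$, with $v(\emptyset,t)=0$ for all $t$ and $v(a,t)=\mathbb E_{b\sim a}[v(b,t)]$. The virtual value function is $\phi(b,t)=v(b,t)-\frac{1-F(t)}{f(t)}v_t(b,t)$, $v_t=\partial v/\partial t$, extended by $\phi(a,t)=\mathbb E_{b\sim a}[\phi(b,t)]$ for $a\in\Delta(\mathcal B)$. Standing assumptions: for $b\ne b'$ in $\mathcal B$ there is $t\in T$ with $\phi(b,t)\neq\phi(b',t)$; and $\max_{b\neq\emptyset}\phi(b,\underline t)<0=\phi(\emptyset,\underline t)$. Terminology. A function $g:T\to\mathbb R$ is single-crossing in $t$ if $\operatorname{sign}[g(t)]\in\{-1,0,1\}$ is a monotonic function of $t$ (either weakly increasing or weakly decreasing). "Monotonic" means weakly increasing or weakly decreasing on $T$. Monopolist's problem. A mechanism is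 a measurable map $(a,p):T\to\Delta(\mathcal B)\times\mathbb R$. It is IC if $v(a(t),t)-p(t)\ge v(a(t'),t)-p(t')$ for all $t,t'\in T$, and IR if $v(a(t),t)-p(t)\ge 0$ for all $t\in T$. The monopolist maximizes $\mathbb E[p(t)]$ over IC and IR mechanisms; by the envelope theorem this objective can be written as $\mathbb E[\sum_{b\in\mathcal B}a_b(t)\phi(b,t)]-[v(a(\underline t),\underline t)-p(\underline t)]$, where $a_b(t)$ is the weight that $a(t)$ puts on $b$. A menu $B\subseteq\mathcal B$ is optimal for the monopolist's problem if there is an optimal mechanism $(a,p)$ with $a(t)\in B$ for all $t$ (so it is deterministic); an optimal menu $B$ is a minimal optimal menu if no $B'\subsetneq B$ is optimal. Upper-envelope problem. This is the unconstrained problem with value $\mathbb E[\max_{b\in\mathcal B}\phi(b,t)]$. A menu $B\subseteq\mathcal B$ is optimal for it if for every $t\in T$ some element of $\operatorname{argmax}_{b\in\mathcal B}\phi(b,t)$ belongs to $B$; it is a minimal optimal menu if moreover no $B'\subsetneq B$ is optimal for it. *)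

theory Defs
  imports "HOL-Probability.Probability"
begin

type_synonym goods_bundle = "nat set"

definition bundles :: "nat \<Rightarrow> goods_bundle set" where
  "bundles n = Pow {1..n}"

(* The probability space of types. Its underlying set is the type interval itself
   (not the whole real line), so measurability of a mechanism only concerns types in the
   interval and its values elsewhere are irrelevant. *)
definition type_dist :: "real \<Rightarrow> real \<Rightarrow> (real \<Rightarrow> real) \<Rightarrow> real measure" where
  "type_dist tlo thi f = density (restrict_space lborel {tlo..thi}) (\<lambda>t. ennreal (f t))"

lemma space_type_dist [simp]: "space (type_dist tlo thi f) = {tlo..thi}"
  by (simp add: type_dist_def space_restrict_space)

lemma sets_type_dist: "sets (type_dist tlo thi f) = sets (restrict_space borel {tlo..thi})"
  by (simp add: type_dist_def cong: sets_restrict_space_cong)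

(* The library's cdf measures {..t}, which is not an event of a space carried by the
   interval, hence the intersection with the space. *)
definition type_cdf :: "real \<Rightarrow> real \<Rightarrow> (real \<Rightarrow> real) \<Rightarrow> real \<Rightarrow> real" where
  "type_cdf tlo thi f t = measure (type_dist tlo thi f) {s \<in> {tlo..thi}. s \<le> t}"

(* vt b stands for the derivative of v b with respect to the type. *)
definition virtual_value ::
  "real \<Rightarrow> real \<Rightarrow> (real \<Rightarrow> real) \<Rightarrow> (goods_bundle \<Rightarrow> real \<Rightarrow> real) \<Rightarrow> (goods_bundle \<Rightarrow> real \<Rightarrow> real)
     \<Rightarrow> goods_bundle \<Rightarrow> real \<Rightarrow> real" where
  "virtual_value tlo thi f v vt b t = v b t - (1 - type_cdf tlo thi f t) / f t * vt b t"

definition exp_value :: "(goods_bundle \<Rightarrow> real \<Rightarrow> real) \<Rightarrow> goods_bundle pmf \<Rightarrow> real \<Rightarrow> real" where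
  "exp_value v a t = measure_pmf.expectation a (\<lambda>b. v b t)"

definition single_crossing_on :: "real set \<Rightarrow> (real \<Rightarrow> real) \<Rightarrow> bool" where
  "single_crossing_on T g \<longleftrightarrow> mono_on T (\<lambda>t. sgn (g t)) \<or> antimono_on T (\<lambda>t. sgn (g t))"

definition monotonic_on :: "real set \<Rightarrow> (real \<Rightarrow> real) \<Rightarrow> bool" where
  "monotonic_on T g \<longleftrightarrow> mono_on T g \<or> antimono_on T g"

(* In the next definitions M is the probability space of types. An allocation is
   measurable as a map into the simplex, i.e. coordinate by coordinate. *)
definition is_mechanism ::
  "nat \<Rightarrow> real measure \<Rightarrow> (real \<Rightarrow> goods_bundle pmf) \<Rightarrow> (real \<Rightarrow> real) \<Rightarrow> bool" where
  "is_mechanism n M a p \<longleftrightarrow>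
     (\<forall>t\<in>space M. set_pmf (a t) \<subseteq> bundles n) \<and>
     (\<forall>b\<in>bundles n. (\<lambda>t. pmf (a t) b) \<in> borel_measurable M) \<and>
     p \<in> borel_measurable M"

definition incentive_compatible ::
  "real measure \<Rightarrow> (goods_bundle \<Rightarrow> real \<Rightarrow> real) \<Rightarrow> (real \<Rightarrow> goods_bundle pmf) \<Rightarrow> (real \<Rightarrow> real) \<Rightarrow> bool" where
  "incentive_compatible M v a p \<longleftrightarrow>
     (\<forall>t\<in>space M. \<forall>t'\<in>space M. exp_value v (a t) t - p t \<ge> exp_value v (a t') t - p t')"

definition individually_rational ::
  "real measure \<Rightarrow> (goods_bundle \<Rightarrow> real \<Rightarrow> real) \<Rightarrow> (real \<Rightarrow> goods_bundle pmf) \<Rightarrow> (real \<Rightarrow> real) \<Rightarrow> bool" where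
  "individually_rational M v a p \<longleftrightarrow> (\<forall>t\<in>space M. exp_value v (a t) t - p t \<ge> 0)"

definition feasible_mechanism ::
  "nat \<Rightarrow> real measure \<Rightarrow> (goods_bundle \<Rightarrow> real \<Rightarrow> real) \<Rightarrow> (real \<Rightarrow> goods_bundle pmf) \<Rightarrow> (real \<Rightarrow> real)
     \<Rightarrow> bool" where
  "feasible_mechanism n M v a p \<longleftrightarrow>
     is_mechanism n M a p \<and> incentive_compatible M v a p \<and> individually_rational M v a p"

(* Incentive compatibility bounds the payments when each v b is bounded on the type space,
   so the Bochner integrals below are then genuine expectations. *)
definition optimal_mechanism ::
  "nat \<Rightarrow> real measure \<Rightarrow> (goods_bundle \<Rightarrow> real \<Rightarrow> real) \<Rightarrow> (real \<Rightarrow> goods_bundle pmf) \<Rightarrow> (real \<Rightarrow> real)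
     \<Rightarrow> bool" where
  "optimal_mechanism n M v a p \<longleftrightarrow>
     feasible_mechanism n M v a p \<and>
     (\<forall>a' p'. feasible_mechanism n M v a' p' \<longrightarrow> (\<integral>t. p' t \<partial>M) \<le> (\<integral>t. p t \<partial>M))"

definition monopolist_optimal_menu ::
  "nat \<Rightarrow> real measure \<Rightarrow> (goods_bundle \<Rightarrow> real \<Rightarrow> real) \<Rightarrow> goods_bundle set \<Rightarrow> bool" where
  "monopolist_optimal_menu n M v B \<longleftrightarrow>
     B \<subseteq> bundles n \<and>
     (\<exists>a p. optimal_mechanism n M v a p \<and> (\<forall>t\<in>space M. \<exists>b\<in>B. a t = return_pmf b))"

definition upper_envelope_optimal_menu ::
  "nat \<Rightarrow> real set \<Rightarrow> (goods_bundle \<Rightarrow> real \<Rightarrow> real) \<Rightarrow> goods_bundle set \<Rightarrow> bool" where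
  "upper_envelope_optimal_menu n T \<phi> B \<longleftrightarrow>
     B \<subseteq> bundles n \<and>
     (\<forall>t\<in>T. \<exists>b\<in>B. is_arg_max (\<lambda>b. \<phi> b t) (\<lambda>b. b \<in> bundles n) b)"

definition minimal_menus :: "(goods_bundle set \<Rightarrow> bool) \<Rightarrow> goods_bundle set set" where
  "minimal_menus optimal = {B. optimal B \<and> \<not> (\<exists>B'. B' \<subset> B \<and> optimal B')}"

end

(* Incentive compatibility alone gives revenue = E[virtual value] - utility of the lowest type,
   so revenue is at most E[max over the menu of the virtual value]. For two bundles whose value
   difference increases, the virtual value difference can only cross zero upwards, so choosing at
   every type a virtual value maximizer, with ties broken towards the larger total increase of v,
   yields an allocation with increasing marginal values, which is implementable. Hence the bound
   is attained exactly by the menus that contain a maximizer for almost every type, and by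
   continuity of the virtual values for every type: even before minimization the two families
   of optimal menus coincide. *)
theory Submission
  imports Defs
begin

section \<open>Calculus on a compact interval\<close>

text \<open>Uniform continuity of \<open>y'\<close> makes the derivative of
  \<open>y s - y' t * s\<close> small on the whole segment between \<open>t\<close> and
  \<open>t'\<close>, and the mean value bound applies. The \<open>eventually\<close> form lets
  finitely many such estimates share one \<open>\<delta>\<close>.\<close>

lemma uniform_linear_approximation:
  fixes y y' :: "real \<Rightarrow> real"
  assumes deriv: "\<And>t. t \<in> {a..b} \<Longrightarrow> (y has_real_derivative y' t) (at t within {a..b})"
    and cont: "continuous_on {a..b} y'" and "\<epsilon> > 0"
  shows "\<forall>\<^sub>F \<delta> in at_right 0. \<forall>t\<in>{a..b}. \<forall>t'\<in>{a..b}. \<bar>t' - t\<bar> \<le> \<delta> \<longrightarrow>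
           \<bar>y t' - y t - y' t * (t' - t)\<bar> \<le> \<epsilon> * \<bar>t' - t\<bar>"
proof -
  have "uniformly_continuous_on {a..b} y'"
    using cont by (intro compact_uniformly_continuous) auto
  then obtain d where d: "d > 0"
    "\<And>s t. s \<in> {a..b} \<Longrightarrow> t \<in> {a..b} \<Longrightarrow> dist s t < d \<Longrightarrow> dist (y' s) (y' t) < \<epsilon>"
    using \<open>\<epsilon> > 0\<close> unfolding uniformly_continuous_on_def by metis
  have "\<bar>y t' - y t - y' t * (t' - t)\<bar> \<le> \<epsilon> * \<bar>t' - t\<bar>"
    if "t \<in> {a..b}" "t' \<in> {a..b}" "\<bar>t' - t\<bar> < d" for t t'
  proof -
    let ?S = "{min t t'..max t t'}"
    have sub: "?S \<subseteq> {a..b}" using that by auto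
    have "norm ((y t' - y' t * t') - (y t - y' t * t)) \<le> \<epsilon> * norm (t' - t)"
    proof (rule field_differentiable_bound[where S = ?S and f' = "\<lambda>s. y' s - y' t"])
      fix s assume s: "s \<in> ?S"
      show "((\<lambda>s. y s - y' t * s) has_field_derivative y' s - y' t) (at s within ?S)"
        using s sub by (auto intro!: derivative_eq_intros DERIV_subset[OF deriv])
      have "dist (y' s) (y' t) < \<epsilon>"
        using that s sub by (intro d) (auto simp: dist_real_def min_def max_def split: if_splits)
      then show "norm (y' s - y' t) \<le> \<epsilon>" by (simp add: dist_real_def)
    qed auto
    then show ?thesis by (simp add: algebra_simps)
  qed
  then show ?thesis
    unfolding eventually_at_right_field using \<open>d > 0\<close> by (intro exI[of _ d]) auto
qed

text \<open>
  Swapping \<open>t\<close> and \<open>t'\<close> in the hypothesis shows that \<open>g\<close> is increasing up to \<open>2 * \<epsilon>\<close> at small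
  scales, so over a uniform partition the errors of the Riemann sums telescope.
\<close>

lemma has_integral_subgradient:
  fixes W g :: "real \<Rightarrow> real"
  assumes "a < b" and int: "g integrable_on {a..b}"
    and sub: "\<And>\<epsilon>. \<epsilon> > 0 \<Longrightarrow> \<forall>\<^sub>F \<delta> in at_right 0. \<forall>t\<in>{a..b}. \<forall>t'\<in>{a..b}. \<bar>t' - t\<bar> \<le> \<delta> \<longrightarrow>
                  W t' - W t \<ge> g t * (t' - t) - \<epsilon> * \<bar>t' - t\<bar>"
  shows "(g has_integral W b - W a) {a..b}"
proof -
  \<comment> \<open>The goal becomes \<open>D b = D a\<close>: \<open>W\<close> is only controlled
    through one-sided linear bounds, so increments of \<open>D\<close> are estimated cell by
    cell.\<close>
  define D where "D t = W t - integral {a..t} g" for t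
  have bound: "\<bar>D b - D a\<bar> \<le> 3 * \<epsilon> * (b - a)" if "\<epsilon> > 0" for \<epsilon>
  proof -
    define h where "h N = (b - a) / real N" for N
    have h0: "h \<longlonglongrightarrow> 0" unfolding h_def by real_asymp
    have "filterlim h (at_right 0) sequentially"
      using h0 \<open>a < b\<close> unfolding filterlim_at h_def
      by (auto intro!: eventually_mono[OF eventually_gt_at_top[of 0]])
    from eventually_compose_filterlim[OF sub[OF that] this]
    have "\<forall>\<^sub>F N in sequentially. N > 0 \<and> (\<forall>t\<in>{a..b}. \<forall>t'\<in>{a..b}. \<bar>t' - t\<bar> \<le> h N \<longrightarrow>
                  W t' - W t \<ge> g t * (t' - t) - \<epsilon> * \<bar>t' - t\<bar>)"
      by (intro eventually_conj eventually_gt_at_top)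
    then have "\<forall>\<^sub>F N in sequentially. \<bar>D b - D a\<bar> \<le> (g b - g a) * h N + 3 * \<epsilon> * (b - a)"
    proof eventually_elim
      case (elim N)
      then have N: "N > 0" and W: "\<And>t t'. t \<in> {a..b} \<Longrightarrow> t' \<in> {a..b} \<Longrightarrow> \<bar>t' - t\<bar> \<le> h N \<Longrightarrow>
                  W t' - W t \<ge> g t * (t' - t) - \<epsilon> * \<bar>t' - t\<bar>" by auto
      have "h N > 0" using N \<open>a < b\<close> by (simp add: h_def)
      \<comment> \<open>One \<open>\<epsilon>\<close> is the slack in the hypothesis on
        \<open>W\<close>, two come from bounding the integral of \<open>g\<close> by its endpoint
        values. The signed difference \<open>g t' - g t\<close> is kept because it
        telescopes.\<close>
      have step: "\<bar>D t' - D t\<bar> \<le> (g t' - g t + 3 * \<epsilon>) * (t' - t)"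
        if t: "t \<in> {a..b}" "t' \<in> {a..b}" "t < t'" "t' - t \<le> h N" for t t'
      proof -
        have near_mono: "g s - 2 * \<epsilon> \<le> g s'" if "s \<in> {t..t'}" "s' \<in> {t..t'}" "s \<le> s'" for s s'
        proof (cases "s = s'")
          case False
          then have "s' - s > 0" using that by simp
          have "W s' - W s \<ge> g s * (s' - s) - \<epsilon> * \<bar>s' - s\<bar>"
               "W s - W s' \<ge> g s' * (s - s') - \<epsilon> * \<bar>s - s'\<bar>"
            using that t W[of s s'] W[of s' s] by auto
          then have "(g s - 2 * \<epsilon>) * (s' - s) \<le> g s' * (s' - s)"
            using that by (simp add: algebra_simps)
          then show ?thesis using \<open>s' - s > 0\<close> by simp
        qed (use \<open>\<epsilon> > 0\<close> in simp)
        have int': "g integrable_on {t..t'}"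
          using int t by (auto intro: integrable_on_subinterval)
        have "D t' - D t = (W t' - W t) - integral {t..t'} g"
          using t Henstock_Kurzweil_Integration.integral_combine[of a t t' g]
            integrable_on_subinterval[OF int, of a t'] by (auto simp: D_def)
        moreover have "W t' - W t \<ge> g t * (t' - t) - \<epsilon> * \<bar>t' - t\<bar>"
               "W t - W t' \<ge> g t' * (t - t') - \<epsilon> * \<bar>t - t'\<bar>"
          using t W[of t t'] W[of t' t] by auto
        moreover have "integral {t..t'} (\<lambda>_. g t - 2 * \<epsilon>) \<le> integral {t..t'} g"
          using near_mono t int' by (intro integral_le) auto
        moreover have "integral {t..t'} g \<le> integral {t..t'} (\<lambda>_. g t' + 2 * \<epsilon>)"
          using near_mono[of _ t'] t int' by (intro integral_le) (auto simp: algebra_simps)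
        ultimately show ?thesis using t by (auto simp: algebra_simps abs_le_iff)
      qed
      define x where "x i = a + real i * h N" for i
      have x: "x i \<in> {a..b}" if "i \<le> N" for i
      proof -
        have "real i * h N \<le> real N * h N" using that \<open>h N > 0\<close> by (intro mult_right_mono) auto
        moreover have "real N * h N = b - a" using N by (simp add: h_def)
        ultimately show ?thesis using \<open>h N > 0\<close> by (auto simp: x_def)
      qed
      have x_step: "x (Suc i) - x i = h N" for i by (simp add: x_def algebra_simps)
      have xN: "x N = b" "x 0 = a" using N by (auto simp: x_def h_def)
      have "\<bar>D b - D a\<bar> = \<bar>\<Sum>i<N. D (x (Suc i)) - D (x i)\<bar>"
        using xN sum_lessThan_telescope[of "\<lambda>i. D (x i)" N] by simp
      also have "\<dots> \<le> (\<Sum>i<N. (g (x (Suc i)) - g (x i) + 3 * \<epsilon>) * h N)"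
      proof (intro order.trans[OF sum_abs] sum_mono)
        fix i assume "i \<in> {..<N}"
        then show "\<bar>D (x (Suc i)) - D (x i)\<bar> \<le> (g (x (Suc i)) - g (x i) + 3 * \<epsilon>) * h N"
          using step[of "x i" "x (Suc i)"] x[of i] x[of "Suc i"] \<open>h N > 0\<close>
          unfolding x_step using x_step[of i] by auto
      qed
      also have "\<dots> = (g b - g a + real N * (3 * \<epsilon>)) * h N"
        using xN sum_lessThan_telescope[of "\<lambda>i. g (x i)" N]
        by (simp add: sum.distrib flip: sum_distrib_right)
      also have "\<dots> = (g b - g a) * h N + 3 * \<epsilon> * (b - a)"
        using N by (simp add: h_def field_simps)
      finally show ?case .
    qed
    moreover have "(\<lambda>N. (g b - g a) * h N + 3 * \<epsilon> * (b - a)) \<longlonglongrightarrow> (g b - g a) * 0 + 3 * \<epsilon> * (b - a)"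
      by (intro tendsto_intros h0)
    ultimately show ?thesis
      by (simp add: tendsto_lowerbound)
  qed
  have "\<bar>D b - D a\<bar> \<le> 0 + e" if "e > 0" for e
  proof -
    have "3 * (e / (3 * (b - a))) * (b - a) = e" using \<open>a < b\<close> by (simp add: field_simps)
    then show ?thesis using bound[of "e / (3 * (b - a))"] \<open>a < b\<close> that by simp
  qed
  then have "\<bar>D b - D a\<bar> \<le> 0" by (rule field_le_epsilon)
  then have "integral {a..b} g = W b - W a" by (simp add: D_def)
  then show ?thesis using int by (simp add: has_integral_iff)
qed

lemma mono_on_imp_deriv_within_nonneg:
  fixes g :: "real \<Rightarrow> real"
  assumes "mono_on {a..b} g" "a < b" "t \<in> {a..b}"
    and "(g has_real_derivative g') (at t within {a..b})"
  shows "g' \<ge> 0"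
proof (rule tendsto_lowerbound)
  show "((\<lambda>s. (g s - g t) / (s - t)) \<longlongrightarrow> g') (at t within {a..b})"
    using assms(4) by (simp add: has_field_derivative_iff)
  have "(g s - g t) / (s - t) \<ge> 0" if "s \<in> {a..b}" for s
    using mono_onD[OF assms(1), of s t] mono_onD[OF assms(1), of t s] that assms(3)
    by (cases "s \<le> t") (auto simp: divide_nonpos_nonpos)
  then show "\<forall>\<^sub>F s in at t within {a..b}. 0 \<le> (g s - g t) / (s - t)"
    by (auto simp: eventually_at_filter)
  show "at t within {a..b} \<noteq> bot"
    using assms by (simp add: trivial_limit_within islimpt_Icc)
qed

lemma set_integrable_lborel_bounded:
  fixes g :: "real \<Rightarrow> real"
  assumes "g \<in> borel_measurable (restrict_space borel {a..b})"
    and "\<And>t. t \<in> {a..b} \<Longrightarrow> \<bar>g t\<bar> \<le> C"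
  shows "set_integrable lborel {a..b} g"
proof (rule set_integrable_bound)
  show "set_integrable lborel {a..b} (\<lambda>_. C)"
    by (auto simp: set_integrable_def emeasure_lborel_Icc_eq intro!: integrable_real_indicator)
  show "set_borel_measurable lborel {a..b} g"
    using assms(1) by (simp add: set_borel_measurable_def borel_measurable_restrict_space_iff)
  show "AE x in lborel. x \<in> {a..b} \<longrightarrow> norm (g x) \<le> norm C"
    using assms(2) by force
qed

lemma continuous_on_MAX:
  fixes h :: "'i \<Rightarrow> 'a::topological_space \<Rightarrow> real"
  assumes "finite B" "B \<noteq> {}" "\<And>b. b \<in> B \<Longrightarrow> continuous_on S (h b)"
  shows "continuous_on S (\<lambda>t. MAX b\<in>B. h b t)"
  using assms
proof (induction rule: finite_ne_induct)
  case (insert b B)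
  then have "(\<lambda>t. MAX b\<in>insert b B. h b t) = (\<lambda>t. max (h b t) (MAX b\<in>B. h b t))"
    by auto
  then show ?case using insert by (auto intro!: continuous_intros)
qed auto

section \<open>The type distribution and virtual values\<close>

text \<open>Setting of the upper bound on revenue; \<open>monotone_screening\<close> adds the
  conditions under which the bound is attained.\<close>

locale screening =
  fixes n :: nat and tlo thi :: real and f :: "real \<Rightarrow> real"
    and v vt :: "goods_bundle \<Rightarrow> real \<Rightarrow> real"
  assumes types: "tlo < thi"
    and density_cont: "continuous_on {tlo..thi} f"
    and density_pos: "\<And>t. t \<in> {tlo..thi} \<Longrightarrow> f t > 0"
    and density_prob: "prob_space (type_dist tlo thi f)"
    and v_deriv: "\<And>b t. b \<in> bundles n \<Longrightarrow> t \<in> {tlo..thi} \<Longrightarrow>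
                    (v b has_real_derivative vt b t) (at t within {tlo..thi})"
    and vt_cont: "\<And>b. b \<in> bundles n \<Longrightarrow> continuous_on {tlo..thi} (vt b)"
begin

abbreviation "T \<equiv> {tlo..thi}"
abbreviation "M \<equiv> type_dist tlo thi f"
abbreviation "F \<equiv> type_cdf tlo thi f"
abbreviation "\<phi> \<equiv> virtual_value tlo thi f v vt"
abbreviation "envelope B t \<equiv> MAX b\<in>B. \<phi> b t"

lemma finite_bundles [simp]: "finite (bundles n)"
  by (simp add: bundles_def)

lemma bundles_nonempty [simp]: "bundles n \<noteq> {}"
  by (auto simp: bundles_def)

lemma measurable_type_dist: "borel_measurable M = borel_measurable (restrict_space borel T)"
  by (intro measurable_cong_sets sets_type_dist refl)

lemma continuous_imp_measurable: "continuous_on T g \<Longrightarrow> g \<in> borel_measurable M"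
  for g :: "real \<Rightarrow> real"
  unfolding measurable_type_dist by (rule borel_measurable_continuous_on_restrict)

lemma continuous_imp_bounded:
  fixes g :: "real \<Rightarrow> real"
  assumes "continuous_on T g"
  obtains C where "\<And>t. t \<in> T \<Longrightarrow> \<bar>g t\<bar> \<le> C"
proof -
  have "bounded (g ` T)"
    using assms by (intro compact_imp_bounded compact_continuous_image) auto
  then show ?thesis using that unfolding bounded_iff by (metis imageI real_norm_def)
qed

lemma continuous_family_bounded:
  fixes g :: "goods_bundle \<Rightarrow> real \<Rightarrow> real"
  assumes "\<And>b. b \<in> bundles n \<Longrightarrow> continuous_on T (g b)"
  obtains C where "\<And>b t. b \<in> bundles n \<Longrightarrow> t \<in> T \<Longrightarrow> \<bar>g b t\<bar> \<le> C"
proof -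
  have "bounded (\<Union>b\<in>bundles n. g b ` T)"
    using assms by (intro bounded_UN ballI compact_imp_bounded compact_continuous_image) auto
  then obtain C where "\<forall>x\<in>(\<Union>b\<in>bundles n. g b ` T). \<bar>x\<bar> \<le> C"
    by (auto simp: bounded_iff)
  then show ?thesis using that[of C] by blast
qed

lemma integrable_if_bounded:
  fixes g :: "real \<Rightarrow> real"
  assumes "g \<in> borel_measurable M" "\<And>t. t \<in> T \<Longrightarrow> \<bar>g t\<bar> \<le> C"
  shows "g integrable_on T"
  using assms unfolding measurable_type_dist
  by (intro set_borel_integral_eq_integral set_integrable_lborel_bounded)

lemma integrable_density_times:
  fixes g :: "real \<Rightarrow> real"
  assumes g: "g \<in> borel_measurable M" "\<And>t. t \<in> T \<Longrightarrow> \<bar>g t\<bar> \<le> C"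
  shows "set_integrable lborel T (\<lambda>t. f t * g t)"
proof -
  obtain C' where C': "\<And>t. t \<in> T \<Longrightarrow> \<bar>f t\<bar> \<le> C'"
    using continuous_imp_bounded[OF density_cont] by blast
  have "(\<lambda>t. f t * g t) \<in> borel_measurable (restrict_space borel T)"
    using g(1) continuous_imp_measurable[OF density_cont] unfolding measurable_type_dist
    by (rule borel_measurable_times[rotated])
  moreover have "\<bar>f t * g t\<bar> \<le> C' * C" if "t \<in> T" for t
    unfolding abs_mult using C'[OF that] g(2)[OF that] by (intro mult_mono) auto
  ultimately show ?thesis by (rule set_integrable_lborel_bounded)
qed

text \<open>Turns expectations over types into gauge integrals, where the fundamental theorem and
  the splitting of intervals are available.\<close>

lemma expectation_eq:
  fixes g :: "real \<Rightarrow> real"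
  assumes g: "g \<in> borel_measurable M" "\<And>t. t \<in> T \<Longrightarrow> \<bar>g t\<bar> \<le> C"
  shows "(\<integral>t. g t \<partial>M) = integral T (\<lambda>t. f t * g t)"
proof -
  have meas: "borel_measurable (restrict_space lborel T) = borel_measurable M"
    by (intro measurable_cong_sets) (auto simp: type_dist_def)
  have "(\<integral>t. g t \<partial>M) = (\<integral>t. f t *\<^sub>R g t \<partial>restrict_space lborel T)"
    unfolding type_dist_def
    using g continuous_imp_measurable[OF density_cont] density_pos
    by (intro integral_density) (auto simp: meas space_restrict_space less_imp_le
          intro!: AE_I2)
  also have "\<dots> = (LINT t:T|lborel. f t * g t)"
    by (subst integral_restrict_space) (auto simp: set_lebesgue_integral_def)
  also have "\<dots> = integral T (\<lambda>t. f t * g t)"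
    by (intro set_borel_integral_eq_integral integrable_density_times[OF g])
  finally show ?thesis .
qed

text \<open>Writing the probability as the expectation of an indicator makes \<open>F\<close> an
  antiderivative of the continuous density.\<close>

lemma cdf_eq_integral:
  assumes "t \<in> T"
  shows "F t = integral {tlo..t} f"
proof -
  have ev: "{tlo..t} \<in> sets M"
    using assms by (auto simp: sets_type_dist sets_restrict_space intro!: image_eqI[of _ _ "{tlo..t}"])
  have eq: "{s \<in> T. s \<le> t} = {tlo..t}" using assms by auto
  have "F t = (\<integral>s. indicator {tlo..t} s \<partial>M)"
    using ev assms unfolding type_cdf_def eq by (simp add: min_absorb1)
  also have "\<dots> = integral T (\<lambda>s. f s * indicator {tlo..t} s)"
    using ev by (intro expectation_eq[where C = 1] borel_measurable_indicator) (auto simp: indicator_def)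
  also have "\<dots> = integral T (\<lambda>s. if s \<in> {tlo..t} then f s else 0)"
    by (intro integral_cong) (auto simp: indicator_def)
  also have "\<dots> = integral {tlo..t} f"
    using assms by (subst integral_restrict_Int) (simp add: min_absorb1)
  finally show ?thesis .
qed

lemma cdf_lo: "F tlo = 0"
  using types cdf_eq_integral[of tlo] by simp

lemma cdf_hi: "F thi = 1"
proof -
  have "{s \<in> T. s \<le> thi} = space M" by auto
  then show ?thesis
    unfolding type_cdf_def using prob_space.prob_space[OF density_prob] by simp
qed

lemma cdf_le_1: "F t \<le> 1"
  unfolding type_cdf_def by (rule prob_space.prob_le_1[OF density_prob])

lemma cdf_deriv:
  assumes "t \<in> T"
  shows "(F has_real_derivative f t) (at t within T)"
  using integral_has_real_derivative[OF density_cont assms]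
  by (rule has_field_derivative_transform_within[where d = 1])
    (use assms in \<open>auto simp: cdf_eq_integral\<close>)

lemma cdf_cont: "continuous_on T F"
  using cdf_deriv by (rule DERIV_continuous_on)

lemma v_cont: "b \<in> bundles n \<Longrightarrow> continuous_on T (v b)"
  using v_deriv by (rule DERIV_continuous_on)

lemma \<phi>_cont: "b \<in> bundles n \<Longrightarrow> continuous_on T (\<phi> b)"
  unfolding virtual_value_def
  by (intro continuous_intros v_cont vt_cont cdf_cont density_cont ballI
      less_imp_neq[THEN not_sym] density_pos)

text \<open>The product rule yields \<open>(1 - F t) * vt b t - f t * v b t\<close>; factoring out
  \<open>- f t\<close> leaves exactly the virtual value.\<close>

lemma survival_value_deriv:
  assumes "b \<in> bundles n" "t \<in> T"
  shows "((\<lambda>s. (1 - F s) * v b s) has_real_derivative - (f t * \<phi> b t)) (at t within T)"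
proof -
  have "((\<lambda>s. (1 - F s) * v b s) has_real_derivative (0 - f t) * v b t + vt b t * (1 - F t)) (at t within T)"
    by (intro DERIV_mult DERIV_diff DERIV_const cdf_deriv v_deriv assms)
  also have "(0 - f t) * v b t + vt b t * (1 - F t) = - (f t * \<phi> b t)"
    using density_pos[OF assms(2)] by (simp add: virtual_value_def field_simps)
  finally show ?thesis .
qed

section \<open>Expected virtual values and the upper envelope\<close>

lemma exp_value_eq:
  assumes "set_pmf a \<subseteq> bundles n"
  shows "exp_value g a t = (\<Sum>b\<in>bundles n. pmf a b * g b t)"
  unfolding exp_value_def using assms
  by (subst integral_measure_pmf_real[where A = "bundles n"]) (auto simp: mult.commute)

text \<open>A weighted average is at most the maximum. Bounding by the menu \<open>B\<close> that
  carries the allocation, not by all bundles, is what later links revenue to the menu.\<close>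

lemma exp_value_le_envelope:
  assumes "set_pmf a \<subseteq> B" "B \<subseteq> bundles n"
  shows "exp_value \<phi> a t \<le> envelope B t"
proof -
  have fin: "finite B" using assms(2) by (rule finite_subset) simp
  have "exp_value \<phi> a t = (\<Sum>b\<in>B. pmf a b * \<phi> b t)"
    unfolding exp_value_def using assms fin
    by (subst integral_measure_pmf_real[where A = B]) (auto simp: mult.commute)
  also have "\<dots> \<le> (\<Sum>b\<in>B. pmf a b * envelope B t)"
    using fin by (intro sum_mono mult_left_mono) auto
  also have "\<dots> = envelope B t"
    using sum_pmf_eq_1[OF fin assms(1)] by (simp flip: sum_distrib_right)
  finally show ?thesis .
qed

lemma envelope_mono: "B \<subseteq> bundles n \<Longrightarrow> B \<noteq> {} \<Longrightarrow> envelope B t \<le> envelope (bundles n) t"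
  by (intro Max_mono) auto

lemma envelope_cont: "B \<subseteq> bundles n \<Longrightarrow> B \<noteq> {} \<Longrightarrow> continuous_on T (envelope B)"
  by (intro continuous_on_MAX) (auto intro: \<phi>_cont finite_subset)

lemma is_arg_max_\<phi>_iff:
  "is_arg_max (\<lambda>b. \<phi> b t) (\<lambda>b. b \<in> bundles n) b \<longleftrightarrow>
     b \<in> bundles n \<and> \<phi> b t = envelope (bundles n) t"
proof -
  have "envelope (bundles n) t = \<phi> b t \<longleftrightarrow> (\<forall>b'\<in>bundles n. \<phi> b' t \<le> \<phi> b t)" if "b \<in> bundles n"
    using that by (subst Max_eq_iff) auto
  then show ?thesis by (auto simp: is_arg_max_linorder)
qed

text \<open>Restates the pointwise argmax condition as equality of two continuous functions, the
  form that a comparison of integrals delivers.\<close>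

lemma upper_envelope_optimal_menu_iff:
  "upper_envelope_optimal_menu n T \<phi> B \<longleftrightarrow>
     B \<subseteq> bundles n \<and> B \<noteq> {} \<and> (\<forall>t\<in>T. envelope B t = envelope (bundles n) t)"
proof -
  have "(\<exists>b\<in>B. \<phi> b t = envelope (bundles n) t) \<longleftrightarrow> envelope B t = envelope (bundles n) t"
    if B: "B \<subseteq> bundles n" "B \<noteq> {}" for t
  proof
    have fin: "finite B" using B(1) by (rule finite_subset) simp
    show "envelope B t = envelope (bundles n) t" if "\<exists>b\<in>B. \<phi> b t = envelope (bundles n) t"
      using that envelope_mono[OF B, of t] fin
      by (metis (mono_tags, lifting) Max_ge finite_imageI image_eqI order_antisym)
    show "\<exists>b\<in>B. \<phi> b t = envelope (bundles n) t" if "envelope B t = envelope (bundles n) t"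
      using Max_in[of "(\<lambda>b. \<phi> b t) ` B"] fin B that by auto
  qed
  \<comment> \<open>A type exists, so an optimal menu contains some maximizer and is
    nonempty.\<close>
  moreover have "tlo \<in> T" using types by simp
  ultimately show ?thesis
    unfolding upper_envelope_optimal_menu_def is_arg_max_\<phi>_iff by blast
qed

section \<open>Revenue of feasible mechanisms\<close>

text \<open>Incentive compatibility between \<open>t\<close> and \<open>tlo\<close>, in both
  directions, keeps \<open>p t\<close> within twice the bound on values from
  \<open>p tlo\<close>.\<close>

lemma feasible_payment_bounded:
  assumes feas: "feasible_mechanism n M v a p"
  obtains C where "\<And>t. t \<in> T \<Longrightarrow> \<bar>p t\<bar> \<le> C"
proof -
  have supp: "set_pmf (a t) \<subseteq> bundles n" if "t \<in> T" for t
    using feas that by (simp add: feasible_mechanism_def is_mechanism_def)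
  obtain K where K: "\<And>b t. b \<in> bundles n \<Longrightarrow> t \<in> T \<Longrightarrow> \<bar>v b t\<bar> \<le> K"
    using continuous_family_bounded[of v] v_cont by blast
  have bound: "\<bar>exp_value v (a t) s\<bar> \<le> K" if "t \<in> T" "s \<in> T" for t s
  proof -
    have "\<bar>exp_value v (a t) s\<bar> \<le> (\<Sum>b\<in>bundles n. pmf (a t) b * \<bar>v b s\<bar>)"
      unfolding exp_value_eq[OF supp[OF that(1)]]
      by (rule order.trans[OF sum_abs]) (simp add: abs_mult)
    also have "\<dots> \<le> (\<Sum>b\<in>bundles n. pmf (a t) b * K)"
      using that by (intro sum_mono mult_left_mono K) auto
    also have "\<dots> = K"
      using sum_pmf_eq_1[OF _ supp[OF that(1)]] by (simp flip: sum_distrib_right)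
    finally show ?thesis .
  qed
  have lo: "tlo \<in> T" using types by simp
  have "\<bar>p t\<bar> \<le> 2 * K + \<bar>p tlo\<bar>" if t: "t \<in> T" for t
  proof -
    have "exp_value v (a t) t - p t \<ge> exp_value v (a tlo) t - p tlo"
      "exp_value v (a tlo) tlo - p tlo \<ge> exp_value v (a t) tlo - p t"
      using feas t lo by (auto simp: feasible_mechanism_def incentive_compatible_def)
    with bound[OF t t] bound[OF t lo] bound[OF lo t] bound[OF lo lo] show ?thesis
      by linarith
  qed
  then show thesis by (rule that)
qed

text \<open>
  Weighting the indirect utility \<open>U\<close> by the survival function makes the envelope
  theorem and the integration by parts a single step: incentive compatibility says that
  \<open>(1 - F) * U\<close> lies above its first-order expansion at \<open>t\<close> along the contract of type \<open>t\<close>,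
  whose slope is \<open>f t * (p t - exp_value \<phi> (a t) t)\<close>.
\<close>

lemma revenue_formula:
  assumes feas: "feasible_mechanism n M v a p"
  shows "((\<lambda>t. f t * (p t - exp_value \<phi> (a t) t)) has_integral
            p tlo - exp_value v (a tlo) tlo) T"
    and "(\<lambda>t. f t * p t) integrable_on T"
    and "(\<lambda>t. f t * exp_value \<phi> (a t) t) integrable_on T"
    and "(\<integral>t. p t \<partial>M) =
           integral T (\<lambda>t. f t * exp_value \<phi> (a t) t) - (exp_value v (a tlo) tlo - p tlo)"
proof -
  have supp: "\<And>t. t \<in> T \<Longrightarrow> set_pmf (a t) \<subseteq> bundles n"
    and a_meas: "\<And>b. b \<in> bundles n \<Longrightarrow> (\<lambda>t. pmf (a t) b) \<in> borel_measurable M"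
    and p_meas: "p \<in> borel_measurable M"
    and ic: "\<And>t t'. t \<in> T \<Longrightarrow> t' \<in> T \<Longrightarrow> exp_value v (a t) t - p t \<ge> exp_value v (a t') t - p t'"
    using feas by (auto simp: feasible_mechanism_def is_mechanism_def incentive_compatible_def)
  obtain P where P: "\<And>t. t \<in> T \<Longrightarrow> \<bar>p t\<bar> \<le> P"
    using feasible_payment_bounded[OF feas] by blast
  let ?\<phi>a = "\<lambda>t. exp_value \<phi> (a t) t"
  define g where "g t = f t * (p t - ?\<phi>a t)" for t
  \<comment> \<open>The weight is 1 at \<open>tlo\<close> and 0 at \<open>thi\<close>, so
    \<open>W thi - W tlo\<close> is minus the utility of the lowest type.\<close>
  define W where "W t = (1 - F t) * (exp_value v (a t) t - p t)" for t
  show p_int: "(\<lambda>t. f t * p t) integrable_on T"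
    using set_borel_integral_eq_integral integrable_density_times[OF p_meas P] by blast
  have "(\<lambda>t. f t * (\<Sum>b\<in>bundles n. pmf (a t) b * \<phi> b t)) integrable_on T"
    unfolding sum_distrib_left
  proof (intro integrable_sum)
    fix b assume b: "b \<in> bundles n"
    obtain C where C: "\<And>t. t \<in> T \<Longrightarrow> \<bar>\<phi> b t\<bar> \<le> C"
      using continuous_imp_bounded[OF \<phi>_cont[OF b]] by blast
    have "\<bar>pmf (a t) b * \<phi> b t\<bar> \<le> C" if "t \<in> T" for t
      using mult_mono[OF pmf_le_1 C[OF that]] by (simp add: abs_mult)
    then show "(\<lambda>t. f t * (pmf (a t) b * \<phi> b t)) integrable_on T"
      using b by (intro set_borel_integral_eq_integral integrable_density_times
          borel_measurable_times a_meas continuous_imp_measurable \<phi>_cont)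
  qed simp
  then show \<phi>_int: "(\<lambda>t. f t * ?\<phi>a t) integrable_on T"
    by (rule integrable_eq) (simp add: exp_value_eq supp)
  have g_int: "g integrable_on T"
    unfolding g_def right_diff_distrib using p_int \<phi>_int by (rule integrable_diff)
  have "(g has_integral W thi - W tlo) T"
  proof (rule has_integral_subgradient[OF types g_int])
    fix \<epsilon> :: real assume "\<epsilon> > 0"
    \<comment> \<open>The expected value contributes an error \<open>e\<close> per unit of distance,
      as the weights sum to 1, and the payment contributes \<open>\<bar>P\<bar> * e\<close>;
      together they give \<open>\<epsilon>\<close>.\<close>
    define e where "e = \<epsilon> / (1 + \<bar>P\<bar>)"
    have "e > 0" using \<open>\<epsilon> > 0\<close> by (simp add: e_def)
    let ?Y = "\<lambda>b s. (1 - F s) * v b s"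
    have "\<forall>\<^sub>F \<delta> in at_right 0. \<forall>b\<in>bundles n. \<forall>t\<in>T. \<forall>t'\<in>T. \<bar>t' - t\<bar> \<le> \<delta> \<longrightarrow>
            \<bar>?Y b t' - ?Y b t - - (f t * \<phi> b t) * (t' - t)\<bar> \<le> e * \<bar>t' - t\<bar>"
      using \<open>e > 0\<close>
      by (intro eventually_ball_finite ballI uniform_linear_approximation survival_value_deriv
          continuous_intros density_cont \<phi>_cont) auto
    moreover have "\<forall>\<^sub>F \<delta> in at_right 0. \<forall>t\<in>T. \<forall>t'\<in>T. \<bar>t' - t\<bar> \<le> \<delta> \<longrightarrow>
            \<bar>F t' - F t - f t * (t' - t)\<bar> \<le> e * \<bar>t' - t\<bar>"
      using \<open>e > 0\<close> by (intro uniform_linear_approximation cdf_deriv density_cont)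
    ultimately show "\<forall>\<^sub>F \<delta> in at_right 0. \<forall>t\<in>T. \<forall>t'\<in>T. \<bar>t' - t\<bar> \<le> \<delta> \<longrightarrow>
            g t * (t' - t) - \<epsilon> * \<bar>t' - t\<bar> \<le> W t' - W t"
    proof (eventually_elim, intro ballI impI)
      fix \<delta> t t'
      assume Y: "\<forall>b\<in>bundles n. \<forall>t\<in>T. \<forall>t'\<in>T. \<bar>t' - t\<bar> \<le> \<delta> \<longrightarrow>
            \<bar>?Y b t' - ?Y b t - - (f t * \<phi> b t) * (t' - t)\<bar> \<le> e * \<bar>t' - t\<bar>"
        and F: "\<forall>t\<in>T. \<forall>t'\<in>T. \<bar>t' - t\<bar> \<le> \<delta> \<longrightarrow>
            \<bar>F t' - F t - f t * (t' - t)\<bar> \<le> e * \<bar>t' - t\<bar>"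
        and t: "t \<in> T" "t' \<in> T" "\<bar>t' - t\<bar> \<le> \<delta>"
      let ?d = "\<bar>t' - t\<bar>"
      have F': "p t * (F t' - F t) \<ge> p t * f t * (t' - t) - \<bar>P\<bar> * (e * ?d)"
      proof -
        have "\<bar>p t * (F t' - F t - f t * (t' - t))\<bar> \<le> \<bar>P\<bar> * (e * ?d)"
          unfolding abs_mult using F t order.trans[OF P abs_ge_self]
          by (intro mult_mono) auto
        then show ?thesis by (simp add: algebra_simps abs_le_iff)
      qed
      \<comment> \<open>The contract of type \<open>t\<close> is held fixed while the type moves to
        \<open>t'\<close>, so only smooth functions of the type are expanded.\<close>
      have "(\<Sum>b\<in>bundles n. pmf (a t) b * (- (f t * \<phi> b t) * (t' - t) - e * ?d))
              \<le> (\<Sum>b\<in>bundles n. pmf (a t) b * (?Y b t' - ?Y b t))"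
      proof (intro sum_mono mult_left_mono)
        fix b assume "b \<in> bundles n"
        with Y t have "\<bar>?Y b t' - ?Y b t - - (f t * \<phi> b t) * (t' - t)\<bar> \<le> e * ?d" by blast
        then show "- (f t * \<phi> b t) * (t' - t) - e * ?d \<le> ?Y b t' - ?Y b t"
          unfolding abs_le_iff by linarith
      qed simp
      also have "(\<Sum>b\<in>bundles n. pmf (a t) b * (- (f t * \<phi> b t) * (t' - t) - e * ?d)) =
          (\<Sum>b\<in>bundles n. - (f t * (t' - t)) * (pmf (a t) b * \<phi> b t)) - (\<Sum>b\<in>bundles n. pmf (a t) b) * (e * ?d)"
        unfolding sum_distrib_right sum_subtractf[symmetric]
        by (intro sum.cong) (auto simp: algebra_simps)
      also have "\<dots> = - (f t * (t' - t)) * ?\<phi>a t - e * ?d"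
        using sum_pmf_eq_1[OF _ supp[OF t(1)]]
        by (simp add: exp_value_eq[OF supp[OF t(1)]] sum_distrib_left)
      also have "(\<Sum>b\<in>bundles n. pmf (a t) b * (?Y b t' - ?Y b t)) =
          (1 - F t') * exp_value v (a t) t' - (1 - F t) * exp_value v (a t) t"
        unfolding exp_value_eq[OF supp[OF t(1)]] sum_distrib_left sum_subtractf[symmetric]
        by (intro sum.cong) (auto simp: algebra_simps)
      finally have "- (f t * (t' - t)) * ?\<phi>a t - e * ?d + (p t * f t * (t' - t) - \<bar>P\<bar> * (e * ?d))
          \<le> (1 - F t') * (exp_value v (a t) t' - p t) - W t"
        using F' by (simp add: W_def algebra_simps)
      \<comment> \<open>Here type \<open>t'\<close> weakly prefers its own contract to that of
        \<open>t\<close>; the nonnegative weight preserves the inequality.\<close>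
      also have "(1 - F t') * (exp_value v (a t) t' - p t) - W t \<le> W t' - W t"
        unfolding W_def using ic[OF t(2,1)] cdf_le_1[of t']
        by (intro diff_right_mono mult_left_mono) auto
      also have "- (f t * (t' - t)) * ?\<phi>a t - e * ?d + (p t * f t * (t' - t) - \<bar>P\<bar> * (e * ?d)) =
          g t * (t' - t) - (1 + \<bar>P\<bar>) * e * ?d"
        by (simp add: g_def algebra_simps)
      also have "(1 + \<bar>P\<bar>) * e = \<epsilon>" by (simp add: e_def add_nonneg_eq_0_iff)
      finally show "g t * (t' - t) - \<epsilon> * ?d \<le> W t' - W t" .
    qed
  qed
  then show g_integral: "((\<lambda>t. f t * (p t - exp_value \<phi> (a t) t)) has_integral
            p tlo - exp_value v (a tlo) tlo) T"
    by (simp add: W_def g_def[abs_def] cdf_lo cdf_hi)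
  have "(\<integral>t. p t \<partial>M) = integral T (\<lambda>t. f t * p t)"
    using p_meas P by (rule expectation_eq)
  also have "\<dots> = integral T (\<lambda>t. f t * ?\<phi>a t) + integral T (\<lambda>t. f t * p t - f t * ?\<phi>a t)"
    by (simp add: integral_diff[OF p_int \<phi>_int])
  also have "integral T (\<lambda>t. f t * p t - f t * ?\<phi>a t) = p tlo - exp_value v (a tlo) tlo"
    using integral_unique[OF g_integral] by (simp add: right_diff_distrib)
  finally show "(\<integral>t. p t \<partial>M) =
           integral T (\<lambda>t. f t * ?\<phi>a t) - (exp_value v (a tlo) tlo - p tlo)" by simp
qed

text \<open>Individual rationality makes the subtracted utility of the lowest type nonnegative, and
  the virtual surplus is bounded pointwise. With all bundles as \<open>B\<close> this is the global
  bound; with a deterministic menu it shows what that menu can earn.\<close>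

lemma revenue_le_envelope:
  assumes feas: "feasible_mechanism n M v a p"
    and supp: "\<And>t. t \<in> T \<Longrightarrow> set_pmf (a t) \<subseteq> B" and B: "B \<subseteq> bundles n" "B \<noteq> {}"
  shows "(\<integral>t. p t \<partial>M) \<le> integral T (\<lambda>t. f t * envelope B t)"
proof -
  have "integral T (\<lambda>t. f t * exp_value \<phi> (a t) t) \<le> integral T (\<lambda>t. f t * envelope B t)"
    using exp_value_le_envelope[OF supp B(1)] density_pos
    by (intro integral_le revenue_formula[OF feas] integrable_continuous_interval continuous_intros
        density_cont envelope_cont B mult_left_mono) (auto simp: less_imp_le)
  moreover have "exp_value v (a tlo) tlo - p tlo \<ge> 0"
    using feas types by (auto simp: feasible_mechanism_def individually_rational_def)
  ultimately show ?thesis unfolding revenue_formula(4)[OF feas] by simp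
qed

end

section \<open>Bundles ordered by the growth of their value\<close>

locale monotone_screening = screening +
  assumes v_empty: "\<And>t. t \<in> T \<Longrightarrow> v {} t = 0"
    and generic: "\<And>b b'. b \<in> bundles n \<Longrightarrow> b' \<in> bundles n \<Longrightarrow> b \<noteq> b' \<Longrightarrow>
                    \<exists>t\<in>T. \<phi> b t \<noteq> \<phi> b' t"
    and lowest_type: "\<And>b. b \<in> bundles n \<Longrightarrow> b \<noteq> {} \<Longrightarrow> \<phi> b tlo < \<phi> {} tlo"
    and phi_single_crossing: "\<And>b b'. b \<in> bundles n \<Longrightarrow> b' \<in> bundles n \<Longrightarrow>
                    single_crossing_on T (\<lambda>t. \<phi> b t - \<phi> b' t)"
    and v_monotonic: "\<And>b b'. b \<in> bundles n \<Longrightarrow> b' \<in> bundles n \<Longrightarrow>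
                    monotonic_on T (\<lambda>t. v b t - v b' t)"
begin

text \<open>All value differences are monotonic, so comparing the total increase of two values over
  \<open>T\<close> decides the direction of their difference.\<close>

definition rank :: "goods_bundle \<Rightarrow> real" where
  "rank b = v b thi - v b tlo"

text \<open>A decreasing difference whose total change is nonnegative is constant, hence also
  increasing.\<close>

lemma v_diff_mono:
  assumes b: "b \<in> bundles n" "b' \<in> bundles n" and "rank b' \<le> rank b"
  shows "mono_on T (\<lambda>t. v b t - v b' t)"
  using v_monotonic[OF b] unfolding monotonic_on_def
proof
  assume anti: "antimono_on T (\<lambda>t. v b t - v b' t)"
  define c where "c = v b tlo - v b' tlo"
  have "v b t - v b' t = c" if "t \<in> T" for t
    using monotone_onD[OF anti, of tlo t] monotone_onD[OF anti, of t thi] that \<open>rank b' \<le> rank b\<close>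
    by (simp add: rank_def c_def)
  then show ?thesis by (intro mono_onI) simp
qed

lemma vt_mono_rank:
  assumes "b \<in> bundles n" "b' \<in> bundles n" "rank b' \<le> rank b" "t \<in> T"
  shows "vt b' t \<le> vt b t"
  using mono_on_imp_deriv_within_nonneg[OF v_diff_mono[OF assms(1-3)] types assms(4)
      DERIV_diff[OF v_deriv[OF assms(1,4)] v_deriv[OF assms(2,4)]]]
  by simp

text \<open>
  Where \<open>v b - v b'\<close> increases, the virtual value difference never exceeds its value at \<open>thi\<close>,
  where it equals \<open>v b - v b'\<close>; so it cannot cross zero from above.
\<close>

lemma \<phi>_crossing_upward:
  assumes b: "b \<in> bundles n" "b' \<in> bundles n" "rank b' \<le> rank b"
    and t: "t \<in> T" "t' \<in> T" "t \<le> t'" and le: "\<phi> b' t \<le> \<phi> b t"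
  shows "\<phi> b' t' \<le> \<phi> b t'"
  using phi_single_crossing[OF b(1,2)] unfolding single_crossing_on_def
proof
  assume "mono_on T (\<lambda>t. sgn (\<phi> b t - \<phi> b' t))"
  from mono_onD[OF this t] le show ?thesis
    by (auto simp: sgn_if split: if_splits)
next
  assume anti: "antimono_on T (\<lambda>t. sgn (\<phi> b t - \<phi> b' t))"
  have "\<phi> b t - \<phi> b' t \<le> v b t - v b' t"
    using mult_left_mono[OF vt_mono_rank[OF b t(1)], of "(1 - F t) / f t"]
      cdf_le_1[of t] density_pos[OF t(1)]
    by (simp add: virtual_value_def)
  also have "\<dots> \<le> v b thi - v b' thi"
    using mono_onD[OF v_diff_mono[OF b], of t thi] t by simp
  also have "\<dots> = \<phi> b thi - \<phi> b' thi"
    by (simp add: virtual_value_def cdf_hi)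
  finally show ?thesis
    using monotone_onD[OF anti, of t' thi] t le
    by (auto simp: sgn_if split: if_splits)
qed

text \<open>With equal ranks the difference of values is monotone in both directions, so it is
  constant and the marginal values agree. The virtual value difference is then the same constant,
  the two inequalities force it to be 0, and genericity excludes distinct bundles.\<close>

lemma rank_eq_imp_eq:
  assumes b: "b \<in> bundles n" "b' \<in> bundles n" "rank b = rank b'"
    and t: "t \<in> T" "t' \<in> T" and le: "\<phi> b' t \<le> \<phi> b t" "\<phi> b t' \<le> \<phi> b' t'"
  shows "b = b'"
proof (rule ccontr)
  assume "b \<noteq> b'"
  define c where "c = v b tlo - v b' tlo"
  have diff: "\<phi> b s - \<phi> b' s = c" if s: "s \<in> T" for s
  proof -
    have "vt b s = vt b' s"
      using vt_mono_rank[of b b' s] vt_mono_rank[of b' b s] b s by simp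
    moreover have "v b s - v b' s = c"
      using mono_onD[OF v_diff_mono[of b b'], of tlo s] mono_onD[OF v_diff_mono[of b' b], of tlo s] b s
      by (simp add: c_def)
    ultimately show ?thesis by (simp add: virtual_value_def)
  qed
  have "c = 0" using diff[OF t(1)] diff[OF t(2)] le by linarith
  then have "\<forall>s\<in>T. \<phi> b s = \<phi> b' s" using diff by simp
  with generic[OF b(1,2) \<open>b \<noteq> b'\<close>] show False by blast
qed

section \<open>A monotone selection of virtual value maximizers\<close>

text \<open>
  Ties have to be broken consistently: on an interval where two bundles tie, only the one of
  higher rank can remain optimal for higher types.
\<close>

definition choice :: "goods_bundle set \<Rightarrow> real \<Rightarrow> goods_bundle" where
  "choice B t = (SOME b. b \<in> B \<and> \<phi> b t = envelope B t \<and>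
                   (\<forall>b'\<in>B. \<phi> b' t = envelope B t \<longrightarrow> rank b' \<le> rank b))"

context
  fixes B assumes B: "B \<subseteq> bundles n" "B \<noteq> {}"
begin

lemma finite_B: "finite B"
  using B(1) by (rule finite_subset) simp

lemma choice:
  shows choice_mem: "choice B t \<in> B"
    and choice_envelope: "\<phi> (choice B t) t = envelope B t"
    and choice_rank: "\<And>c. c \<in> B \<Longrightarrow> \<phi> c t = envelope B t \<Longrightarrow> rank c \<le> rank (choice B t)"
proof -
  let ?A = "{b\<in>B. \<phi> b t = envelope B t}"
  have "envelope B t \<in> (\<lambda>b. \<phi> b t) ` B" using finite_B B by (intro Max_in) auto
  then have "?A \<noteq> {}" by auto
  have fin: "finite (rank ` ?A)" using finite_B by simp
  with \<open>?A \<noteq> {}\<close> have "Max (rank ` ?A) \<in> rank ` ?A" by (intro Max_in) auto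
  then obtain b where "b \<in> ?A" and Max_b: "Max (rank ` ?A) = rank b" by auto
  moreover have "\<forall>b'\<in>?A. rank b' \<le> rank b"
    unfolding Max_b[symmetric] by (intro ballI Max_ge[OF fin] imageI)
  ultimately have "\<exists>b. b \<in> B \<and> \<phi> b t = envelope B t \<and>
               (\<forall>b'\<in>B. \<phi> b' t = envelope B t \<longrightarrow> rank b' \<le> rank b)" by blast
  then have "choice B t \<in> B \<and> \<phi> (choice B t) t = envelope B t \<and>
               (\<forall>b'\<in>B. \<phi> b' t = envelope B t \<longrightarrow> rank b' \<le> rank (choice B t))"
    unfolding choice_def by (rule someI_ex)
  then show "choice B t \<in> B" "\<phi> (choice B t) t = envelope B t"
    "\<And>c. c \<in> B \<Longrightarrow> \<phi> c t = envelope B t \<Longrightarrow> rank c \<le> rank (choice B t)"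
    by simp_all
qed

lemma choice_bundle: "choice B t \<in> bundles n"
  using choice_mem B by blast

lemma choice_ge: "b \<in> B \<Longrightarrow> \<phi> b t \<le> \<phi> (choice B t) t"
  unfolding choice_envelope using finite_B by (intro Max_ge) auto

text \<open>If the rank fell from \<open>t\<close> to \<open>t'\<close>, the bundle chosen at
  \<open>t\<close> would by upward crossing still be a maximizer at \<open>t'\<close>, and the
  tie-breaking there would favor it.\<close>

lemma choice_rank_mono: "mono_on T (\<lambda>t. rank (choice B t))"
proof (rule mono_onI, rule ccontr)
  fix t t' assume t: "t \<in> T" "t' \<in> T" "t \<le> t'" and less: "\<not> rank (choice B t) \<le> rank (choice B t')"
  then have "\<phi> (choice B t') t' \<le> \<phi> (choice B t) t'"
    by (intro \<phi>_crossing_upward[OF choice_bundle choice_bundle _ t] choice_ge choice_mem) simp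
  then have "\<phi> (choice B t) t' = envelope B t'"
    using choice_ge[OF choice_mem, of t t'] by (simp add: choice_envelope)
  with choice_rank[OF choice_mem this] less show False by simp
qed

lemma choice_eq_if_rank_eq:
  assumes "t \<in> T" "t' \<in> T" "rank (choice B t) = rank (choice B t')"
  shows "choice B t = choice B t'"
  by (rule rank_eq_imp_eq[OF choice_bundle choice_bundle assms(3,1,2)]; rule choice_ge[OF choice_mem])

text \<open>The rank of the choice is monotone, hence Borel, and it determines the chosen bundle; so
  the types choosing a given bundle form a level set of that function.\<close>

lemma choice_measurable: "choice B \<in> measurable M (count_space (bundles n))"
  unfolding measurable_count_space_eq2[OF finite_bundles]
proof (intro conjI ballI)
  show "choice B \<in> space M \<rightarrow> bundles n" using choice_bundle by simp
  fix b
  have rank_meas: "(\<lambda>t. rank (choice B t)) \<in> borel_measurable M"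
    unfolding measurable_type_dist by (rule borel_measurable_mono_on_fnc[OF choice_rank_mono])
  show "choice B -` {b} \<inter> space M \<in> sets M"
  proof (cases "\<exists>t\<in>T. choice B t = b")
    case True
    then obtain t\<^sub>0 where t\<^sub>0: "t\<^sub>0 \<in> T" "choice B t\<^sub>0 = b" by blast
    have "choice B t = b \<longleftrightarrow> rank (choice B t) = rank b" if "t \<in> T" for t
      using choice_eq_if_rank_eq[OF that t\<^sub>0(1)] t\<^sub>0(2) by metis
    then have "choice B -` {b} \<inter> space M = (\<lambda>t. rank (choice B t)) -` {rank b} \<inter> space M"
      by auto
    also have "\<dots> \<in> sets M" by (rule measurable_sets[OF rank_meas]) simp
    finally show ?thesis .
  next
    case False
    then have "choice B -` {b} \<inter> space M = {}" by auto
    then show ?thesis by simp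
  qed
qed

lemma choice_compose_measurable:
  fixes g :: "goods_bundle \<Rightarrow> real \<Rightarrow> real"
  assumes "\<And>b. b \<in> bundles n \<Longrightarrow> g b \<in> borel_measurable M"
  shows "(\<lambda>t. g (choice B t) t) \<in> borel_measurable M"
  by (rule measurable_compose_countable'[OF assms choice_measurable]) (simp_all add: countable_finite)

section \<open>Payments that implement the selection\<close>

text \<open>The indirect utility prescribed by the envelope formula, with no rent for the lowest
  type.\<close>

definition utility :: "real \<Rightarrow> real" where
  "utility t = integral {tlo..t} (\<lambda>s. vt (choice B s) s)"

definition payment :: "real \<Rightarrow> real" where
  "payment t = v (choice B t) t - utility t"

lemma marginal_utility_integrable: "(\<lambda>s. vt (choice B s) s) integrable_on T"
proof -
  obtain C where "\<And>b t. b \<in> bundles n \<Longrightarrow> t \<in> T \<Longrightarrow> \<bar>vt b t\<bar> \<le> C"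
    using continuous_family_bounded[of vt] vt_cont by blast
  then have "\<bar>vt (choice B t) t\<bar> \<le> C" if "t \<in> T" for t
    using choice_bundle that by blast
  moreover have "(\<lambda>s. vt (choice B s) s) \<in> borel_measurable M"
    by (rule choice_compose_measurable[OF continuous_imp_measurable[OF vt_cont]])
  ultimately show ?thesis by (intro integrable_if_bounded)
qed

lemma payment_measurable: "payment \<in> borel_measurable M"
proof -
  have "utility \<in> borel_measurable M"
    unfolding utility_def[abs_def]
    by (intro continuous_imp_measurable indefinite_integral_continuous_1 marginal_utility_integrable)
  moreover have "(\<lambda>t. v (choice B t) t) \<in> borel_measurable M"
    by (rule choice_compose_measurable[OF continuous_imp_measurable[OF v_cont]])
  ultimately show ?thesis
    unfolding payment_def[abs_def] by (rule borel_measurable_diff[rotated])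
qed

text \<open>Between \<open>t\<close> and \<open>t'\<close> the chosen rank, and with it the marginal
  value, lies between those of the two endpoint choices; integrating gives both bounds. The first
  deters \<open>t'\<close> from imitating \<open>t\<close>, the second deters \<open>t\<close> from
  imitating \<open>t'\<close>.\<close>

lemma utility_increment:
  assumes t: "t \<in> T" "t' \<in> T" "t \<le> t'"
  shows "v (choice B t) t' - v (choice B t) t \<le> utility t' - utility t"
    and "utility t' - utility t \<le> v (choice B t') t' - v (choice B t') t"
proof -
  have sub: "{t..t'} \<subseteq> T" using t by auto
  have ftc: "(vt b has_integral v b t' - v b t) {t..t'}" if "b \<in> bundles n" for b
    using t(3) v_deriv[OF that] sub
    by (intro fundamental_theorem_of_calculus)
      (auto simp flip: has_real_derivative_iff_has_vector_derivative
        intro!: DERIV_subset[where s = T and t = "{t..t'}"])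
  have "utility t' - utility t = integral {t..t'} (\<lambda>s. vt (choice B s) s)"
    using Henstock_Kurzweil_Integration.integral_combine[of tlo t t' "\<lambda>s. vt (choice B s) s"] t
      integrable_on_subinterval[OF marginal_utility_integrable, of tlo t']
    by (auto simp: utility_def)
  moreover have "(\<lambda>s. vt (choice B s) s) integrable_on {t..t'}"
    using integrable_on_subinterval[OF marginal_utility_integrable sub] .
  ultimately have inc: "((\<lambda>s. vt (choice B s) s) has_integral utility t' - utility t) {t..t'}"
    by (simp add: has_integral_iff)
  have mono: "vt (choice B s) r \<le> vt (choice B s') r"
    if "s \<in> {t..t'}" "s' \<in> {t..t'}" "s \<le> s'" "r \<in> {t..t'}" for s s' r
    using that sub by (intro vt_mono_rank choice_bundle mono_onD[OF choice_rank_mono]) auto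
  show "v (choice B t) t' - v (choice B t) t \<le> utility t' - utility t"
    by (rule has_integral_le[OF ftc[OF choice_bundle] inc]) (use t mono in auto)
  show "utility t' - utility t \<le> v (choice B t') t' - v (choice B t') t"
    by (rule has_integral_le[OF inc ftc[OF choice_bundle]]) (use t mono in auto)
qed

lemma exp_value_return: "exp_value g (return_pmf b) t = g b t"
  by (simp add: exp_value_def)

context
  assumes choice_lo: "choice B tlo = {}"
begin

text \<open>Individual rationality follows from incentive compatibility towards \<open>tlo\<close>,
  whose contract is the empty bundle at price 0 and is worth 0 to every type.\<close>

lemma choice_feasible: "feasible_mechanism n M v (\<lambda>t. return_pmf (choice B t)) payment"
proof -
  have ic: "v (choice B t) t - payment t \<ge> v (choice B t') t - payment t'"
    if "t \<in> T" "t' \<in> T" for t t'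
    using utility_increment[of t t'] utility_increment[of t' t] that
    by (cases "t \<le> t'") (auto simp: payment_def)
  have lo: "tlo \<in> T" using types by simp
  have "v (choice B t) t - payment t \<ge> 0" if "t \<in> T" for t
    using ic[OF that lo] that lo by (simp add: payment_def choice_lo v_empty utility_def)
  moreover have "(\<lambda>t. pmf (return_pmf (choice B t)) b) \<in> borel_measurable M" for b
    unfolding pmf_return by (rule choice_compose_measurable[where g = "\<lambda>b' _. indicator {b} b'"]) simp
  ultimately show ?thesis
    unfolding feasible_mechanism_def is_mechanism_def incentive_compatible_def
      individually_rational_def exp_value_return
    using ic payment_measurable choice_bundle by auto
qed

text \<open>Both inequalities behind \<open>revenue_le_envelope\<close> are tight: the lowest type
  earns no rent and every choice lies on the envelope.\<close>

lemma choice_revenue: "(\<integral>t. payment t \<partial>M) = integral T (\<lambda>t. f t * envelope B t)"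
  using revenue_formula(4)[OF choice_feasible] unfolding exp_value_return
  by (simp add: choice_envelope payment_def utility_def)

end

end

section \<open>Equivalence of the two optimality notions for menus\<close>

text \<open>At \<open>tlo\<close> the empty bundle strictly beats every other bundle, so a choice on
  the full envelope must be the empty bundle.\<close>

lemma upper_envelope_choice_lo:
  assumes "upper_envelope_optimal_menu n T \<phi> B"
  shows "choice B tlo = {}"
proof -
  have B: "B \<subseteq> bundles n" "B \<noteq> {}" and env: "envelope B tlo = envelope (bundles n) tlo"
    using assms types by (auto simp: upper_envelope_optimal_menu_iff)
  have "\<phi> {} tlo \<le> \<phi> (choice B tlo) tlo"
    unfolding choice_envelope[OF B] env by (intro Max_ge) (auto simp: bundles_def)
  then show ?thesis using lowest_type[OF choice_bundle[OF B, of tlo]] by fastforce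
qed

lemma upper_envelope_implementable:
  assumes "upper_envelope_optimal_menu n T \<phi> B"
  obtains a p where "feasible_mechanism n M v a p" "\<forall>t. \<exists>b\<in>B. a t = return_pmf b"
    "(\<integral>t. p t \<partial>M) = integral T (\<lambda>t. f t * envelope (bundles n) t)"
proof -
  have B: "B \<subseteq> bundles n" "B \<noteq> {}" and env: "\<And>t. t \<in> T \<Longrightarrow> envelope B t = envelope (bundles n) t"
    using assms by (auto simp: upper_envelope_optimal_menu_iff)
  note lo = upper_envelope_choice_lo[OF assms]
  have "(\<integral>t. payment B t \<partial>M) = integral T (\<lambda>t. f t * envelope (bundles n) t)"
    unfolding choice_revenue[OF B lo] using env by (intro integral_cong) simp
  then show ?thesis
    using that choice_feasible[OF B lo] choice_mem[OF B] by blast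
qed

lemma monopolist_optimal_menu_iff:
  "monopolist_optimal_menu n M v B \<longleftrightarrow> upper_envelope_optimal_menu n T \<phi> B"
proof
  assume upper: "upper_envelope_optimal_menu n T \<phi> B"
  then obtain a p where ap: "feasible_mechanism n M v a p" "\<forall>t. \<exists>b\<in>B. a t = return_pmf b"
    "(\<integral>t. p t \<partial>M) = integral T (\<lambda>t. f t * envelope (bundles n) t)"
    by (rule upper_envelope_implementable)
  have "(\<integral>t. p' t \<partial>M) \<le> (\<integral>t. p t \<partial>M)" if "feasible_mechanism n M v a' p'" for a' p'
    unfolding ap(3) using that
    by (intro revenue_le_envelope[OF that]) (auto simp: feasible_mechanism_def is_mechanism_def)
  then show "monopolist_optimal_menu n M v B"
    using ap upper unfolding monopolist_optimal_menu_def optimal_mechanism_def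
      upper_envelope_optimal_menu_iff by blast
next
  assume "monopolist_optimal_menu n M v B"
  then obtain a p where B: "B \<subseteq> bundles n" and opt: "optimal_mechanism n M v a p"
    and det: "\<And>t. t \<in> T \<Longrightarrow> \<exists>b\<in>B. a t = return_pmf b"
    by (auto simp: monopolist_optimal_menu_def)
  have "B \<noteq> {}" using det[of tlo] types by auto
  \<comment> \<open>The full menu supplies a feasible competitor that earns the global bound, so the
    optimal mechanism must earn at least as much.\<close>
  have "upper_envelope_optimal_menu n T \<phi> (bundles n)"
    by (simp add: upper_envelope_optimal_menu_iff)
  then obtain a' p' where "feasible_mechanism n M v a' p'"
    "(\<integral>t. p' t \<partial>M) = integral T (\<lambda>t. f t * envelope (bundles n) t)"
    by (rule upper_envelope_implementable)
  then have "integral T (\<lambda>t. f t * envelope (bundles n) t) \<le> (\<integral>t. p t \<partial>M)"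
    using opt by (metis optimal_mechanism_def)
  also have "\<dots> \<le> integral T (\<lambda>t. f t * envelope B t)"
    using opt det B \<open>B \<noteq> {}\<close> by (intro revenue_le_envelope) (fastforce simp: optimal_mechanism_def)+
  finally have le: "integral T (\<lambda>t. f t * envelope (bundles n) t) \<le> integral T (\<lambda>t. f t * envelope B t)" .
  let ?gap = "\<lambda>t. f t * envelope (bundles n) t - f t * envelope B t"
  have cont: "continuous_on T (\<lambda>t. f t * envelope A t)" if "A \<subseteq> bundles n" "A \<noteq> {}" for A
    using that by (intro continuous_intros density_cont envelope_cont)
  have gap_nonneg: "?gap t \<ge> 0" if "t \<in> T" for t
    using envelope_mono[OF B \<open>B \<noteq> {}\<close>, of t] density_pos[OF that] by simp
  have "integral T ?gap \<le> 0"
    using le cont B \<open>B \<noteq> {}\<close>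
    by (subst integral_diff) (auto intro!: integrable_continuous_interval)
  moreover have gap_cont: "continuous_on T ?gap"
    using cont B \<open>B \<noteq> {}\<close> by (intro continuous_on_diff) auto
  moreover have "integral T ?gap \<ge> 0"
    using gap_nonneg gap_cont by (intro integral_nonneg integrable_continuous_interval) auto
  \<comment> \<open>A continuous nonnegative gap with zero integral vanishes at every type, not
    merely almost everywhere.\<close>
  ultimately have "\<forall>t\<in>T. ?gap t = 0"
    using integral_eq_0_iff[OF gap_cont types gap_nonneg] by linarith
  then show "upper_envelope_optimal_menu n T \<phi> B"
    using B \<open>B \<noteq> {}\<close> density_pos unfolding upper_envelope_optimal_menu_iff by force
qed

end

theorem theorem1:
  fixes n :: nat
    and tlo thi :: real
    and f :: "real \<Rightarrow> real"
    and v vt \<phi> :: "goods_bundle \<Rightarrow> real \<Rightarrow> real"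
  assumes phi: "\<phi> = virtual_value tlo thi f v vt"
    and n_pos: "n \<ge> 1"
    and types: "tlo < thi"
    and density_cont: "continuous_on {tlo..thi} f"
    and density_pos: "\<And>t. t \<in> {tlo..thi} \<Longrightarrow> f t > 0"
    and density_prob: "prob_space (type_dist tlo thi f)"
    and v_deriv: "\<And>b t. b \<in> bundles n \<Longrightarrow> t \<in> {tlo..thi} \<Longrightarrow>
                    (v b has_real_derivative vt b t) (at t within {tlo..thi})"
    and vt_cont: "\<And>b. b \<in> bundles n \<Longrightarrow> continuous_on {tlo..thi} (vt b)"
    and v_empty: "\<And>t. t \<in> {tlo..thi} \<Longrightarrow> v {} t = 0"
    and generic: "\<And>b b'. b \<in> bundles n \<Longrightarrow> b' \<in> bundles n \<Longrightarrow> b \<noteq> b' \<Longrightarrow>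
                    \<exists>t\<in>{tlo..thi}. \<phi> b t \<noteq> \<phi> b' t"
    and lowest_type: "(MAX b\<in>bundles n - {{}}. \<phi> b tlo) < 0" "\<phi> {} tlo = 0"
    and phi_single_crossing: "\<And>b b'. b \<in> bundles n \<Longrightarrow> b' \<in> bundles n \<Longrightarrow>
                    single_crossing_on {tlo..thi} (\<lambda>t. \<phi> b t - \<phi> b' t)"
    and v_monotonic: "\<And>b b'. b \<in> bundles n \<Longrightarrow> b' \<in> bundles n \<Longrightarrow>
                    monotonic_on {tlo..thi} (\<lambda>t. v b t - v b' t)"
  shows "minimal_menus (monopolist_optimal_menu n (type_dist tlo thi f) v) =
         minimal_menus (upper_envelope_optimal_menu n {tlo..thi} \<phi>)"
proof -
  have low: "\<phi> b tlo < \<phi> {} tlo" if "b \<in> bundles n" "b \<noteq> {}" for b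
  proof -
    have "\<phi> b tlo \<le> (MAX b\<in>bundles n - {{}}. \<phi> b tlo)"
      using that by (intro Max_ge) (auto simp: bundles_def)
    with lowest_type show ?thesis by simp
  qed
  interpret monotone_screening n tlo thi f v vt
    by (rule monotone_screening.intro; (rule screening.intro monotone_screening_axioms.intro)?)
      (use assms low in \<open>simp_all add: phi\<close>)
  have "monopolist_optimal_menu n (type_dist tlo thi f) v = upper_envelope_optimal_menu n {tlo..thi} \<phi>"
    unfolding phi by (intro ext monopolist_optimal_menu_iff)
  then show ?thesis by simp
qed

end
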